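(* Let $q$ be an odd prime power and $c\in\mathbb F_{q^2}\setminus\mathbb F_q$. Let $L=DS(\mathbb D_{q^2},c)$ be the quasigroup on $\mathbb F_{q^2}$ with multiplication $x*y=x+(y-x)\circ c$, where $\circ$ is the multiplication of the quadratic nearfield $\mathbb D_{q^2}$. Then $L$ is a division sudoku (of rank $q$) satisfying $\sigma(L)\ge q+1$.
   Context: $\mathbb F_q$ is the field of order $q$, regarded as a subfield of $\mathbb F_{q^2}$. For an odd prime power $q$, the quadratic nearfield is $\mathbb D_{q^2}=(\mathbb F_{q^2},+,\circ,0,1)$, where $+$ is the addition of the field $\mathbb F_{q^2}$ and $x\circ y=xy$ if $x$ is a square in $\mathbb F_{q^2}$, while $x\circ y=xy^q$ otherwise (products and powers on the right-hand sides taken in the field $\mathbb F_{q^2}$). For $c\in\mathbb F_{q^2}\setminus\{0,1\}$ the operation $x*y=x+(y-x)\circ c$ defines a quasigroup on $\mathbb F_{q^2}$ (known result of Stein). A quasigroup on a finite set $X$ is identified with its multiplication table, a latin square $L$ on $X$. Let $|X|=m^2$. A sudoku partition of $X$ is a partition $\{X_1,\dots,X_m\}$ of $X$ into $m$ blocks of size $m$. With $O(L)=\{(x,y,L(x,y)):x,y\in X\}$, the bands, stacks and piles of $L$ are $B_i=\{(x,y,z)\in O(L):x\in X_i\}$, $S_i=\{(x,y,z)\in O(L):y\in X_i\}$, $P_i=\{(x,y,z)\in O(L):z\in X_i\}$. $L$ is a division sudoku of rank $m$ with respect to the sudoku partition if for all $i,j$: every $z\in X$ occurs as a third coordinate in $B_i\cap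 S_j$, every $y\in X$ occurs as a second coordinate in $B_i\cap P_j$, and every $x\in X$ occurs as a first coordinate in $S_i\cap P_j$. $\sigma(L)$ is the number of sudoku partitions of $X$ with respect to which $L$ is a division sudoku. *)

theory Defs
  imports
    "HOL-Number_Theory.Prime_Powers"
    "HOL-Computational_Algebra.Nth_Powers"
    "HOL-Library.Cardinality"
    "HOL-Library.Disjoint_Sets"
begin

definition subfield_set :: "'a::field set \<Rightarrow> bool" where
  "subfield_set F \<longleftrightarrow>
     0 \<in> F \<and> 1 \<in> F \<and>
     (\<forall>x\<in>F. \<forall>y\<in>F. x + y \<in> F \<and> x * y \<in> F) \<and>
     (\<forall>x\<in>F. - x \<in> F \<and> inverse x \<in> F)"

text \<open>Multiplication of the quadratic nearfield of order \<open>q\<^sup>2\<close>; the type \<open>'a\<close> plays the role of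
  the field of order \<open>q\<^sup>2\<close>. The element \<open>0\<close> counts as a square, which is immaterial because
  both branches give \<open>0\<close> for \<open>x = 0\<close>.\<close>

definition qnf_mult :: "nat \<Rightarrow> 'a::field \<Rightarrow> 'a \<Rightarrow> 'a" where
  "qnf_mult q x y = (if is_square x then x * y else x * y ^ q)"

definition DS :: "nat \<Rightarrow> 'a::field \<Rightarrow> 'a \<Rightarrow> 'a \<Rightarrow> 'a" where
  "DS q c x y = x + qnf_mult q (y - x) c"

definition latin_square_on :: "'a set \<Rightarrow> ('a \<Rightarrow> 'a \<Rightarrow> 'a) \<Rightarrow> bool" where
  "latin_square_on X L \<longleftrightarrow>
     (\<forall>x\<in>X. bij_betw (\<lambda>y. L x y) X X) \<and> (\<forall>y\<in>X. bij_betw (\<lambda>x. L x y) X X)"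

definition sudoku_partition :: "nat \<Rightarrow> 'a set \<Rightarrow> 'a set set \<Rightarrow> bool" where
  "sudoku_partition m X P \<longleftrightarrow>
     finite X \<and> card X = m\<^sup>2 \<and> partition_on X P \<and> card P = m \<and> (\<forall>A\<in>P. card A = m)"

definition ortho_array :: "'a set \<Rightarrow> ('a \<Rightarrow> 'a \<Rightarrow> 'a) \<Rightarrow> ('a \<times> 'a \<times> 'a) set" where
  "ortho_array X L = {(x, y, L x y) | x y. x \<in> X \<and> y \<in> X}"

definition band :: "'a set \<Rightarrow> ('a \<Rightarrow> 'a \<Rightarrow> 'a) \<Rightarrow> 'a set \<Rightarrow> ('a \<times> 'a \<times> 'a) set" where
  "band X L A = {(x, y, z) \<in> ortho_array X L. x \<in> A}"

definition stack :: "'a set \<Rightarrow> ('a \<Rightarrow> 'a \<Rightarrow> 'a) \<Rightarrow> 'a set \<Rightarrow> ('a \<times> 'a \<times> 'a) set" where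
  "stack X L A = {(x, y, z) \<in> ortho_array X L. y \<in> A}"

definition pile :: "'a set \<Rightarrow> ('a \<Rightarrow> 'a \<Rightarrow> 'a) \<Rightarrow> 'a set \<Rightarrow> ('a \<times> 'a \<times> 'a) set" where
  "pile X L A = {(x, y, z) \<in> ortho_array X L. z \<in> A}"

definition division_sudoku_wrt ::
  "nat \<Rightarrow> 'a set \<Rightarrow> ('a \<Rightarrow> 'a \<Rightarrow> 'a) \<Rightarrow> 'a set set \<Rightarrow> bool" where
  "division_sudoku_wrt m X L P \<longleftrightarrow>
     latin_square_on X L \<and> sudoku_partition m X P \<and>
     (\<forall>A\<in>P. \<forall>B\<in>P.
        (\<forall>z\<in>X. \<exists>x y. (x, y, z) \<in> band X L A \<inter> stack X L B) \<and>
        (\<forall>y\<in>X. \<exists>x z. (x, y, z) \<in> band X L A \<inter> pile X L B) \<and>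
        (\<forall>x\<in>X. \<exists>y z. (x, y, z) \<in> stack X L A \<inter> pile X L B))"

definition division_sudoku :: "nat \<Rightarrow> 'a set \<Rightarrow> ('a \<Rightarrow> 'a \<Rightarrow> 'a) \<Rightarrow> bool" where
  "division_sudoku m X L \<longleftrightarrow> (\<exists>P. division_sudoku_wrt m X L P)"

text \<open>The number of partitions depends on \<open>m\<close> only nominally: \<open>m\<close> is determined by
  \<open>card X = m\<^sup>2\<close>.\<close>

definition num_sudoku_partitions :: "nat \<Rightarrow> 'a set \<Rightarrow> ('a \<Rightarrow> 'a \<Rightarrow> 'a) \<Rightarrow> nat" where
  "num_sudoku_partitions m X L = card {P. division_sudoku_wrt m X L P}"

end

theory Submission
  imports Defs "HOL-Number_Theory.Residues" "HOL-Computational_Algebra.Polynomial"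
begin

text \<open>
  Write $K$ for the field of order $q^2$ and $\bar x = x^q$ for the Frobenius conjugation, which is
  an automorphism of $K$ of order two with fixed field $F$. The sudoku partitions come from affine
  geometry: $K$ is a plane over $F$, and each of its $q + 1$ lines $Fv$ through the origin
  partitions $K$ into $q$ cosets of size $q$.

  For a cell $(x, y)$ put $d = y - x$. Then the entry is $x + d \circ c$, and each of the three
  conditions on a division sudoku asks for a $d$ in a prescribed coset of $Fv$ such that
  $d \circ c$ lies in a prescribed coset of $Fv$ (lemma \<open>ex_qnf_mult_in_cosets\<close>). By counting, it
  suffices that $d \mapsto d \circ c$ is injective modulo $Fv$ on every coset of $Fv$: if $d - e$
  and $d \circ c - e \circ c$ are both in $Fv$, then $d = e$ (lemma \<open>qnf_mult_inj_mod_line\<close>).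

  If $d$ and $e$ are both squares or both nonsquares, then $(d - e)c$ or $(d - e)\bar c$ is in $Fv$,
  and $d \neq e$ would put $c$ or $\bar c$, hence $c$, into $F$. If $d$ is a square and $e$ is not,
  then $d - e$ and $dc - e\bar c$ are both fixed by the reflection
  $\rho(x) = \bar x\, v / \bar v$, the $F$-linear involution of the plane with axis $Fv$. Comparing
  the two conditions gives $(c - \bar c)(\rho(d) + e) = 0$, so $e = -\rho(d)$. But $\rho$ preserves
  squares, because $v / \bar v$ is the $(q-1)$-st power of $1/v$ and $q - 1$ is even, and $-1$ is a
  square of $K$. So $e$ is a square after all, which is a contradiction.

  The same injectivity also gives the latin property, with the line through $d - e$ as $Fv$.
\<close>

section \<open>Finite subfields and the Frobenius map\<close>

lemma subfield_set_diff:
  assumes "subfield_set F" "x \<in> F" "y \<in> F"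
  shows "x - y \<in> F"
  using assms unfolding subfield_set_def by (metis add_uminus_conv_diff)

lemma subfield_set_divide:
  assumes "subfield_set F" "x \<in> F" "y \<in> F"
  shows "x / y \<in> F"
  using assms unfolding subfield_set_def by (metis divide_inverse)

text \<open>Multiplication by $x \neq 0$ permutes the nonzero elements of $F$, so it does not change their
  product.\<close>

lemma subfield_set_power_card:
  fixes F :: "'a::field set"
  assumes F: "subfield_set F" and fin: "finite F" and x: "x \<in> F"
  shows "x ^ card F = x"
proof (cases "x = 0")
  case True
  have "card F \<noteq> 0"
    using fin x by auto
  then show ?thesis
    using True by simp
next
  case False
  have card: "Suc (card (F - {0})) = card F"
    using F fin by (metis card.remove subfield_set_def)
  have "(\<Prod>y\<in>F - {0}. x * y) = (\<Prod>y\<in>F - {0}. y)"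
    by (rule prod.reindex_bij_witness[of _ "\<lambda>y. y / x" "\<lambda>y. x * y"])
      (use False F x in \<open>auto intro: subfield_set_divide simp: subfield_set_def\<close>)
  then have "x ^ card (F - {0}) * \<Prod>(F - {0}) = \<Prod>(F - {0})"
    by (simp add: prod.distrib)
  moreover have "\<Prod>(F - {0}) \<noteq> 0"
    using fin by simp
  ultimately have "x ^ card (F - {0}) = 1"
    by simp
  then show ?thesis
    using card by (metis mult.right_neutral power_Suc)
qed

text \<open>All elements of $F$ are roots of $X^{|F|} - X$, which has no room for further roots.\<close>

lemma subfield_set_eq_fixed_points:
  fixes F :: "'a::field set"
  assumes F: "subfield_set F" and fin: "finite F"
  shows "F = {x. x ^ card F = x}"
proof -
  define p :: "'a poly" where "p = monom 1 (card F) - monom 1 1"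
  have "card F \<ge> card {0, 1 :: 'a}"
    using F fin by (intro card_mono) (auto simp: subfield_set_def)
  then have "card F > 1"
    by simp
  then have "coeff p (card F) = 1"
    by (simp add: p_def)
  then have nz: "p \<noteq> 0"
    by auto
  have deg: "degree p \<le> card F"
    unfolding p_def using \<open>card F > 1\<close>
    by (intro degree_diff_le order_trans[OF degree_monom_le]) auto
  have roots: "{x. poly p x = 0} = {x. x ^ card F = x}"
    by (simp add: p_def poly_monom)
  have "F \<subseteq> {x. x ^ card F = x}"
    using subfield_set_power_card[OF F fin] by blast
  moreover have "finite {x :: 'a. x ^ card F = x}"
    using poly_roots_finite[OF nz] unfolding roots .
  moreover have "card {x :: 'a. x ^ card F = x} \<le> card F"
    using order_trans[OF card_poly_roots_bound[OF nz] deg] unfolding roots .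
  ultimately show ?thesis
    by (simp add: card_seteq)
qed

lemma power_add_of_primepow_CARD:
  fixes x y :: "'a::{field,finite}"
  assumes "primepow q" "CARD('a) = q\<^sup>2"
  shows "(x + y) ^ q = x ^ q + y ^ q"
proof -
  obtain p k where pk: "prime p" "q = p ^ k"
    using assms(1) unfolding primepow_def by auto
  have CHAR: "prime CHAR('a)"
    by (rule prime_CHAR_semidom) (simp add: finite_imp_CHAR_pos)
  have "CHAR('a) dvd p ^ (k * 2)"
    using CHAR_dvd_CARD[where 'a = 'a] assms(2) pk by (simp add: power_mult)
  then have "CHAR('a) = p"
    using CHAR pk(1) prime_dvd_power primes_dvd_imp_eq by blast
  then show ?thesis
    using CHAR pk(2) by (intro freshmans_dream'[where n = k]) simp_all
qed

section \<open>The coset partitions\<close>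

definition line :: "'a::field set \<Rightarrow> 'a \<Rightarrow> 'a set" where
  "line F v = (\<lambda>s. s * v) ` F"

definition line_cosets :: "'a::field set \<Rightarrow> 'a \<Rightarrow> 'a set set" where
  "line_cosets F v = UNIV // {(x, y). y - x \<in> line F v}"

context
  fixes F :: "'a::field set"
  assumes F: "subfield_set F"
begin

lemma zero_in_line: "0 \<in> line F v"
  using F by (force simp: line_def subfield_set_def)

lemma self_in_line: "v \<in> line F v"
  using F by (force simp: line_def subfield_set_def)

lemma line_diff: "x \<in> line F v \<Longrightarrow> y \<in> line F v \<Longrightarrow> x - y \<in> line F v"
  using subfield_set_diff[OF F] by (auto simp: line_def simp flip: left_diff_distrib)

lemma line_minus: "x \<in> line F v \<Longrightarrow> - x \<in> line F v"
  using line_diff[OF zero_in_line] by force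

lemma line_add: "x \<in> line F v \<Longrightarrow> y \<in> line F v \<Longrightarrow> x + y \<in> line F v"
  using line_diff[OF _ line_minus] by force

lemma card_line: "v \<noteq> 0 \<Longrightarrow> card (line F v) = card F"
  by (simp add: line_def card_image inj_on_def)

lemma equiv_line: "equiv UNIV {(x, y). y - x \<in> line F v}"
proof (rule equivI)
  show "refl_on UNIV {(x, y). y - x \<in> line F v}"
    by (auto intro!: refl_onI simp: zero_in_line)
  show "sym {(x, y). y - x \<in> line F v}"
    by (rule symI) (use line_minus in force)
  show "trans {(x, y). y - x \<in> line F v}"
    by (rule transI) (use line_add in force)
qed simp

lemma line_cosetsE:
  assumes "A \<in> line_cosets F v"
  obtains a where "A = {x. x - a \<in> line F v}"
  using assms by (auto simp: line_cosets_def quotient_def)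

lemma sudoku_partition_line_cosets:
  assumes "CARD('a) = q\<^sup>2" "card F = q" "v \<noteq> 0" "q > 0"
  shows "sudoku_partition q UNIV (line_cosets F v)"
proof -
  have fin: "finite (UNIV :: 'a set)"
    using assms by (intro card_ge_0_finite) simp
  have part: "partition_on UNIV (line_cosets F v)"
    unfolding line_cosets_def by (rule partition_on_quotient[OF equiv_line])
  have block: "card A = q" if A: "A \<in> line_cosets F v" for A
  proof -
    obtain a where a: "A = {x. x - a \<in> line F v}"
      using A by (rule line_cosetsE)
    have "A = (\<lambda>x. a + x) ` line F v"
      unfolding a by (force simp: image_iff algebra_simps)
    then show ?thesis
      using assms by (simp add: card_image card_line)
  qed
  have "CARD('a) = (\<Sum>A\<in>line_cosets F v. card A)"
    using fin by (intro product_partition[OF part]) (auto intro: finite_subset)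
  then have "q * q = card (line_cosets F v) * q"
    using block assms by (simp add: power2_eq_square)
  then have "card (line_cosets F v) = q"
    using assms by simp
  then show ?thesis
    using fin part block assms by (simp add: sudoku_partition_def)
qed

text \<open>The line itself can be recovered from its partition: it is the block of $0$.\<close>

lemma line_eq_of_line_cosets_eq:
  assumes "line_cosets F v = line_cosets F w"
  shows "line F v = line F w"
proof -
  have "line F v \<in> line_cosets F v"
    by (auto simp: line_cosets_def quotient_def intro!: exI[of _ 0])
  then obtain a where a: "line F v = {x. x - a \<in> line F w}"
    using assms by (metis line_cosetsE)
  then have "- a \<in> line F w"
    using zero_in_line[of v] by auto
  then show ?thesis
    unfolding a using line_add[of _ w "- a"] line_diff[of _ w "- a"] by force
qed

end

section \<open>Injectivity modulo a line\<close>

locale quadratic_nearfield =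
  fixes q :: nat and F :: "'a::{field,finite} set"
  assumes primepow_q: "primepow q" and odd_q: "odd q"
    and CARD_q: "CARD('a) = q\<^sup>2"
    and subfield: "subfield_set F" and card_F: "card F = q"
begin

lemma frob_add: "(x + y :: 'a) ^ q = x ^ q + y ^ q"
  by (rule power_add_of_primepow_CARD[OF primepow_q CARD_q])

lemma frob_minus: "(- x :: 'a) ^ q = - (x ^ q)"
  using odd_q by simp

lemma frob_diff: "(x - y :: 'a) ^ q = x ^ q - y ^ q"
  using frob_add[of x "- y"] by (simp add: frob_minus)

lemma frob_frob: "((x :: 'a) ^ q) ^ q = x"
proof -
  have "x ^ CARD('a) = x"
    by (rule subfield_set_power_card) (auto simp: subfield_set_def)
  then show ?thesis
    by (simp add: CARD_q power2_eq_square power_mult)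
qed

lemma frob_eq_self_iff: "x ^ q = x \<longleftrightarrow> x \<in> F"
  using subfield_set_eq_fixed_points[OF subfield] card_F by auto

lemma frob_not_in: "c \<notin> F \<Longrightarrow> c ^ q \<notin> F"
  using frob_eq_self_iff frob_frob by metis

text \<open>An element $w = c - \bar c \neq 0$ satisfies $\bar w = -w$, so $-1 = w^{q-1}$, and $q - 1$ is even.\<close>

lemma minus_one_is_square:
  assumes "c \<notin> F"
  shows "is_square (- 1 :: 'a)"
proof -
  define w where "w = c - c ^ q"
  have "w \<noteq> 0"
    using assms frob_eq_self_iff[of c] by (auto simp: w_def)
  have "w ^ q = - w"
    by (simp add: w_def frob_diff frob_frob)
  moreover obtain k where k: "q = Suc (2 * k)"
    using odd_q by (auto elim: oddE)
  ultimately have "w * (w ^ k)\<^sup>2 = w * (- 1)"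
    by (simp add: power_mult[symmetric] mult.commute)
  then have "- 1 = (w ^ k)\<^sup>2"
    using \<open>w \<noteq> 0\<close> by (metis mult_left_cancel)
  then show ?thesis
    by (rule is_nth_powerI)
qed

text \<open>In terms of $\rho(x) = \bar x\, v / \bar v$, this says that $\rho$ fixes the points of its axis $Fv$;
  the denominator is cleared.\<close>

lemma cross_of_mem_line:
  assumes "x \<in> line F v"
  shows "x * v ^ q = x ^ q * v"
proof -
  obtain s where "s \<in> F" "x = s * v"
    using assms by (auto simp: line_def)
  then show ?thesis
    using frob_eq_self_iff[of s] by (simp add: power_mult_distrib)
qed

lemma eq_of_scalar_mult_mem_line:
  assumes c: "c \<notin> F" and "v \<noteq> 0" and "d \<in> line F v" and "d * c \<in> line F v"
  shows "d = 0"
proof (rule ccontr)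
  assume "d \<noteq> 0"
  obtain s t where st: "s \<in> F" "d = s * v" "t \<in> F" "d * c = t * v"
    using assms by (auto simp: line_def)
  then have "s \<noteq> 0" "c = t / s"
    using \<open>d \<noteq> 0\<close> \<open>v \<noteq> 0\<close> by (auto simp: field_simps)
  then show False
    using c st subfield_set_divide[OF subfield] by blast
qed

text \<open>Multiplied by $\bar v$, the two hypotheses say that $d - e$ and $dc - e\bar c$ are fixed by $\rho$. The
  first gives $d + \rho(e) = \rho(d) + e$, and the second gives
  $c\,(d + \rho(e)) = \bar c\,(\rho(d) + e)$; since $c \neq \bar c$, both sums vanish. The conclusion is
  $e = -\rho(d)$.\<close>

lemma eq_neg_reflection_of_mixed:
  assumes c: "c \<notin> F"
    and diff: "d - e \<in> line F v" and prod_diff: "d * c - e * c ^ q \<in> line F v"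
  shows "e * v ^ q = - (d ^ q * v)"
proof -
  have 1: "(d - e) * v ^ q = (d ^ q - e ^ q) * v"
    using cross_of_mem_line[OF diff] by (simp add: frob_diff)
  have 2: "(d * c - e * c ^ q) * v ^ q = (d ^ q * c ^ q - e ^ q * c) * v"
    using cross_of_mem_line[OF prod_diff] by (simp add: frob_diff power_mult_distrib frob_frob)
  have sum: "d * v ^ q + e ^ q * v = d ^ q * v + e * v ^ q"
    using 1 by (simp add: algebra_simps)
  have "c * (d * v ^ q + e ^ q * v) = c ^ q * (d ^ q * v + e * v ^ q)"
    using 2 by (simp add: algebra_simps)
  then have "(c - c ^ q) * (d ^ q * v + e * v ^ q) = 0"
    unfolding sum by (simp add: algebra_simps)
  moreover have "c - c ^ q \<noteq> 0"
    using c frob_eq_self_iff[of c] by auto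
  ultimately show ?thesis
    by (simp add: add_eq_0_iff)
qed

text \<open>With $q = 2k + 1$, the equation reads $e = -(\bar d / v^{2k})$, in which $-1$, $\bar d$ and $v^{2k}$
  are squares.\<close>

lemma neg_reflection_is_square:
  fixes v d e :: 'a
  assumes c: "c \<notin> F" and v: "v \<noteq> 0" and e: "e * v ^ q = - (d ^ q * v)" and d: "is_square d"
  shows "is_square e"
proof -
  obtain k where k: "q = Suc (2 * k)"
    using odd_q by (auto elim: oddE)
  obtain y where y: "d = y\<^sup>2"
    using d by (auto elim: is_nth_powerE)
  have vq: "v ^ q = v * (v ^ k)\<^sup>2"
    by (simp add: k power_mult[symmetric] mult.commute)
  have "v * (e * (v ^ k)\<^sup>2) = e * v ^ q"
    unfolding vq by (simp only: mult_ac)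
  also have "\<dots> = v * (- (d ^ q))"
    unfolding e by simp
  finally have "v * (e * (v ^ k)\<^sup>2) = v * (- (d ^ q))" .
  then have "e * (v ^ k)\<^sup>2 = - (d ^ q)"
    using v by (metis mult_left_cancel)
  moreover have "d ^ q = (y ^ q)\<^sup>2"
    by (simp add: y power_mult[symmetric] mult.commute)
  ultimately have "e = - 1 * (y ^ q / v ^ k)\<^sup>2"
    using v by (simp add: field_simps power_divide)
  then show ?thesis
    using is_nth_power_mult[OF minus_one_is_square[OF c] is_nth_power_nth_power] by metis
qed

lemma qnf_mult_inj_mod_line:
  assumes c: "c \<notin> F" and v: "v \<noteq> 0"
    and diff: "d - e \<in> line F v" and prod_diff: "qnf_mult q d c - qnf_mult q e c \<in> line F v"
  shows "d = e"
proof -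
  have mixed: "is_square e'" if "is_square d'" "d' - e' \<in> line F v"
    "qnf_mult q d' c - qnf_mult q e' c \<in> line F v" for d' e'
  proof (rule ccontr)
    assume "\<not> is_square e'"
    then have "e' * v ^ q = - (d' ^ q * v)"
      using that by (intro eq_neg_reflection_of_mixed[OF c]) (auto simp: qnf_mult_def)
    then show False
      using neg_reflection_is_square[OF c v _ that(1)] \<open>\<not> is_square e'\<close> by blast
  qed
  have "is_square d \<longleftrightarrow> is_square e"
    using mixed[of d e] mixed[of e d] diff prod_diff line_minus[OF subfield]
    by (metis minus_diff_eq)
  then have "(d - e) * c \<in> line F v \<or> (d - e) * c ^ q \<in> line F v"
    using prod_diff by (auto simp: qnf_mult_def algebra_simps split: if_splits)
  then have "d - e = 0"
    using eq_of_scalar_mult_mem_line[OF _ v diff] c frob_not_in[OF c] by blast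
  then show ?thesis
    by simp
qed

section \<open>The division sudokus\<close>

text \<open>If a row or a column repeats an entry for the differences $d$ and $e$, then
  $d \circ c - e \circ c$ is $0$ or $d - e$. In both cases it lies on the line through $d - e$, so that
  injectivity modulo this line applies.\<close>

lemma latin_square_DS:
  assumes c: "c \<notin> F"
  shows "latin_square_on UNIV (DS q c)"
proof -
  have inj: "d = e" if "qnf_mult q d c - qnf_mult q e c \<in> line F (d - e)" for d e
    using qnf_mult_inj_mod_line[OF c _ self_in_line[OF subfield] that] by fastforce
  have row: "inj (\<lambda>y. DS q c x y)" for x
  proof (rule injI)
    fix y z
    assume "DS q c x y = DS q c x z"
    then have "y - x = z - x"
      by (intro inj) (simp add: DS_def zero_in_line[OF subfield])
    then show "y = z"
      by simp
  qed
  have column: "inj (\<lambda>x. DS q c x y)" for y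
  proof (rule injI)
    fix x z
    assume "DS q c x y = DS q c z y"
    then have "qnf_mult q (y - x) c - qnf_mult q (y - z) c = (y - x) - (y - z)"
      by (simp add: DS_def algebra_simps)
    then have "y - x = y - z"
      by (intro inj) (simp add: self_in_line[OF subfield])
    then show "x = z"
      by simp
  qed
  show ?thesis
    unfolding latin_square_on_def bij_betw_def
    using row column finite_UNIV_inj_surj[OF finite] by blast
qed

text \<open>Surjectivity by counting, without forming the quotient by $V = Fv$: the map
  $(s, t) \mapsto (e + s) \circ c - t$ from $V \times V$ to $K$ is injective, and both sides have
  $q^2$ elements.\<close>

lemma ex_qnf_mult_in_cosets:
  assumes c: "c \<notin> F" and v: "v \<noteq> 0"
  obtains d where "d - e \<in> line F v" "qnf_mult q d c - f \<in> line F v"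
proof -
  let ?g = "\<lambda>(s, t). qnf_mult q (e + s) c - t"
  let ?V = "line F v"
  have "inj_on ?g (?V \<times> ?V)"
  proof (rule inj_onI; clarify)
    fix s t s' t'
    assume V: "s \<in> ?V" "t \<in> ?V" "s' \<in> ?V" "t' \<in> ?V"
      and eq: "qnf_mult q (e + s) c - t = qnf_mult q (e + s') c - t'"
    have "qnf_mult q (e + s) c - qnf_mult q (e + s') c = t - t'"
      using eq by (simp add: algebra_simps)
    then have "e + s = e + s'"
      using V by (intro qnf_mult_inj_mod_line[OF c v]) (auto simp: line_diff[OF subfield])
    then show "s = s' \<and> t = t'"
      using eq by simp
  qed
  then have "card (?g ` (?V \<times> ?V)) = CARD('a)"
    by (simp add: card_image card_cartesian_product card_line[OF subfield v] card_F CARD_q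
        power2_eq_square)
  then have "?g ` (?V \<times> ?V) = UNIV"
    by (intro card_eq_UNIV_imp_eq_UNIV) simp_all
  then have "f \<in> ?g ` (?V \<times> ?V)"
    by simp
  then obtain s t where "s \<in> ?V" "t \<in> ?V" "f = qnf_mult q (e + s) c - t"
    by auto
  then show ?thesis
    by (intro that[of "e + s"]) simp_all
qed

lemma division_sudoku_line_cosets:
  assumes c: "c \<notin> F" and v: "v \<noteq> 0"
  shows "division_sudoku_wrt q UNIV (DS q c) (line_cosets F v)"
proof -
  let ?V = "line F v"
  have "q > 0"
    using odd_q by (auto intro: Nat.gr0I)
  have "(\<exists>x y. (x, y, z) \<in> band UNIV (DS q c) A \<inter> stack UNIV (DS q c) B) \<and>
      (\<exists>x y. (x, z, y) \<in> band UNIV (DS q c) A \<inter> pile UNIV (DS q c) B) \<and>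
      (\<exists>x y. (z, x, y) \<in> stack UNIV (DS q c) A \<inter> pile UNIV (DS q c) B)"
    if AB: "A \<in> line_cosets F v" "B \<in> line_cosets F v" for A B z
  proof -
    obtain a where A: "A = {x. x - a \<in> ?V}"
      using AB(1) by (rule line_cosetsE[OF subfield])
    obtain b where B: "B = {x. x - b \<in> ?V}"
      using AB(2) by (rule line_cosetsE[OF subfield])
    note V = line_add[OF subfield, of _ v] line_diff[OF subfield, of _ v] line_minus[OF subfield, of _ v]
    \<comment> \<open>A cell with row \<open>x\<close>, column \<open>x + d\<close> and entry \<open>x + qnf_mult q d c\<close> is determined by \<open>d\<close> and
      any one of the three. Modulo the line, the blocks of the other two prescribe the cosets of
      \<open>d\<close> and of \<open>qnf_mult q d c\<close>.\<close>
    have "\<exists>x y. x \<in> A \<and> y \<in> B \<and> z = DS q c x y"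
    proof -
      obtain d where d: "d - (b - a) \<in> ?V" "qnf_mult q d c - (z - a) \<in> ?V"
        by (rule ex_qnf_mult_in_cosets[OF c v])
      let ?x = "z - qnf_mult q d c"
      have x: "?x - a \<in> ?V"
        using V(3)[OF d(2)] by (simp add: algebra_simps)
      moreover have "?x + d - b \<in> ?V"
        using V(1)[OF x d(1)] by (simp add: algebra_simps)
      ultimately show ?thesis
        by (intro exI[of _ ?x] exI[of _ "?x + d"]) (simp add: A B DS_def)
    qed
    moreover have "\<exists>x. x \<in> A \<and> DS q c x z \<in> B"
    proof -
      obtain d where d: "d - (z - a) \<in> ?V" "qnf_mult q d c - (b - a) \<in> ?V"
        by (rule ex_qnf_mult_in_cosets[OF c v])
      have x: "(z - d) - a \<in> ?V"
        using V(3)[OF d(1)] by (simp add: algebra_simps)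
      moreover have "(z - d) + qnf_mult q d c - b \<in> ?V"
        using V(1)[OF x d(2)] by (simp add: algebra_simps)
      ultimately show ?thesis
        by (intro exI[of _ "z - d"]) (simp add: A B DS_def)
    qed
    moreover have "\<exists>y. y \<in> A \<and> DS q c z y \<in> B"
    proof -
      obtain d where d: "d - (a - z) \<in> ?V" "qnf_mult q d c - (b - z) \<in> ?V"
        by (rule ex_qnf_mult_in_cosets[OF c v])
      then show ?thesis
        by (intro exI[of _ "z + d"]) (simp add: A B DS_def algebra_simps)
    qed
    ultimately show ?thesis
      by (auto simp: band_def stack_def pile_def ortho_array_def)
  qed
  then show ?thesis
    unfolding division_sudoku_wrt_def
    using latin_square_DS[OF c]
      sudoku_partition_line_cosets[OF subfield CARD_q card_F v \<open>q > 0\<close>] by blast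
qed

text \<open>The elements $1$ and $c + s$ with $s \in F$ are the homogeneous coordinates, in the basis $1, c$,
  of the points of the projective line over $F$: they represent every line through the origin once.\<close>

lemma card_line_representatives:
  assumes c: "c \<notin> F"
  shows "card (insert 1 ((\<lambda>s. c + s) ` F)) = q + 1"
proof -
  have "1 \<noteq> c + s" if "s \<in> F" for s
  proof
    assume "1 = c + s"
    then have "c = 1 - s"
      by (simp add: algebra_simps)
    moreover have "1 - s \<in> F"
      using that subfield by (intro subfield_set_diff) (auto simp: subfield_set_def)
    ultimately show False
      using c by simp
  qed
  then have "1 \<notin> (\<lambda>s. c + s) ` F"
    by blast
  then show ?thesis
    by (simp add: card_image card_F)
qed

lemma inj_on_line_cosets:
  assumes c: "c \<notin> F"
  shows "inj_on (line_cosets F) (insert 1 ((\<lambda>s. c + s) ` F))"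
proof -
  note sub = subfield_set_diff[OF subfield]
  have one: "line F 1 = F"
    by (simp add: line_def)
  have mem: "c + s \<notin> F" if "s \<in> F" for s
    using c sub[OF _ that, of "c + s"] by auto
  have off: "s = s'" if s: "s \<in> F" "s' \<in> F" and eq: "line F (c + s) = line F (c + s')" for s s'
  proof (rule ccontr)
    assume "s \<noteq> s'"
    obtain t where t: "t \<in> F" "c + s = t * (c + s')"
      using self_in_line[OF subfield, of "c + s"] eq by (auto simp: line_def)
    have "t \<noteq> 1"
      using t(2) \<open>s \<noteq> s'\<close> by auto
    then have "c = (t * s' - s) / (1 - t)"
      using t(2) by (simp add: field_simps)
    moreover have "(t * s' - s) / (1 - t) \<in> F"
      using s t(1) subfield by (intro subfield_set_divide sub) (auto simp: subfield_set_def)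
    ultimately show False
      using c by simp
  qed
  show ?thesis
  proof (rule inj_onI)
    fix v w
    assume vw: "v \<in> insert 1 ((\<lambda>s. c + s) ` F)" "w \<in> insert 1 ((\<lambda>s. c + s) ` F)"
      and "line_cosets F v = line_cosets F w"
    then have eq: "line F v = line F w"
      by (intro line_eq_of_line_cosets_eq[OF subfield])
    have "v \<in> line F w" "w \<in> line F v"
      using eq self_in_line[OF subfield] by auto
    then have "v = 1 \<longleftrightarrow> w = 1"
      using vw mem one by auto
    then show "v = w"
      using vw off eq by auto
  qed
qed

end

theorem theorem6p12:
  fixes q :: nat and F :: "'a::{field,finite} set" and c :: 'a
  assumes "primepow q" and "odd q"
    and "CARD('a) = q\<^sup>2"
    and "subfield_set F" and "card F = q"
    and "c \<notin> F"
  shows "division_sudoku q (UNIV :: 'a set) (DS q c)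
       \<and> num_sudoku_partitions q (UNIV :: 'a set) (DS q c) \<ge> q + 1"
proof
  interpret quadratic_nearfield q F
    by unfold_locales (use assms in auto)
  show "division_sudoku q (UNIV :: 'a set) (DS q c)"
    unfolding division_sudoku_def
    using division_sudoku_line_cosets[OF \<open>c \<notin> F\<close> one_neq_zero] by blast
  let ?R = "insert 1 ((\<lambda>s. c + s) ` F)"
  have "c + s \<noteq> 0" if "s \<in> F" for s
    using that assms(4,6) by (auto simp: subfield_set_def add_eq_0_iff2)
  then have "line_cosets F ` ?R \<subseteq> {P. division_sudoku_wrt q UNIV (DS q c) P}"
    using division_sudoku_line_cosets[OF \<open>c \<notin> F\<close>] by auto
  then have "card (line_cosets F ` ?R) \<le> num_sudoku_partitions q UNIV (DS q c)"
    unfolding num_sudoku_partitions_def by (intro card_mono) simp_all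
  then show "num_sudoku_partitions q (UNIV :: 'a set) (DS q c) \<ge> q + 1"
    using card_image[OF inj_on_line_cosets[OF \<open>c \<notin> F\<close>]] card_line_representatives[OF \<open>c \<notin> F\<close>]
    by simp
qed

end
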